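(* For all integers $n \geq 5$ and $k \geq 2$ with $n > 2k$, $\sigma(\mathrm{GP}(n,k)) \leq 4$.
   Context: Surrounding Cops and Robbers on a finite simple graph $G$ with $k \geq 1$ cops and one robber: the cops first choose starting vertices (several cops may share a vertex), then the robber chooses a starting vertex not occupied by a cop, and thereafter the cops and the robber alternate moves, the cops moving first. In a move, each player may move to an adjacent vertex or stay put; the robber may never move to, or remain on, a vertex occupied by a cop, so if a cop moves onto the robber's vertex the robber is compelled to move to a neighbouring vertex not occupied by a cop. The cops win if at any time every neighbour of the robber's vertex is occupied by a cop; the robber wins if he avoids this forever. Play is with perfect information. The surrounding cop number $\sigma(G)$ is the least number of cops for which the cops have a winning strategy. For positive integers $n,k$ with $n > 2k$, the generalised Petersen graph $\mathrm{GP}(n,k)$ has vertex set $\{a_0,\dots,a_{n-1}\} \cup \{b_0,\dots,b_{n-1}\}$ and edges $\{a_i,a_{i+1}\}$, $\{a_i,b_i\}$, $\{b_i,b_{i+k}\}$ for each $i \in \{0,\dots,n-1\}$, subscripts modulo $n$. *)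

theory Defs
  imports Main
begin

type_synonym 'a ugraph = "'a set \<times> 'a set set"

abbreviation verts :: "'a ugraph \<Rightarrow> 'a set" where "verts G \<equiv> fst G"

abbreviation edges :: "'a ugraph \<Rightarrow> 'a set set" where "edges G \<equiv> snd G"

definition finite_simple_graph :: "'a ugraph \<Rightarrow> bool" where
  "finite_simple_graph G \<longleftrightarrow>
     finite (verts G) \<and> (\<forall>e \<in> edges G. e \<subseteq> verts G \<and> card e = 2)"

definition adj :: "'a ugraph \<Rightarrow> 'a \<Rightarrow> 'a \<Rightarrow> bool" where
  "adj G u v \<longleftrightarrow> {u, v} \<in> edges G"

text \<open>A configuration of \<open>m\<close> cops is a list of length \<open>m\<close>: entry \<open>i\<close> is the vertex of
  cop \<open>i\<close>, and entries may coincide.\<close>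

definition cop_placement :: "'a ugraph \<Rightarrow> nat \<Rightarrow> 'a list \<Rightarrow> bool" where
  "cop_placement G m c \<longleftrightarrow> length c = m \<and> set c \<subseteq> verts G"

definition cop_move :: "'a ugraph \<Rightarrow> 'a list \<Rightarrow> 'a list \<Rightarrow> bool" where
  "cop_move G c c' \<longleftrightarrow> list_all2 (\<lambda>u v. v = u \<or> adj G u v) c c'"

definition surrounded :: "'a ugraph \<Rightarrow> 'a list \<Rightarrow> 'a \<Rightarrow> bool" where
  "surrounded G c x \<longleftrightarrow> (\<forall>y. adj G x y \<longrightarrow> y \<in> set c)"

text \<open>A strategy for the cops maps the list of all vertices the robber has occupied so far,
  in chronological order, to the next configuration of the cops; its value at the empty list
  is the initial placement. As the cops' own earlier moves are determined by the strategy,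
  this is the complete history of the play. Requiring legal moves also on histories
  that cannot arise in a legal play is no restriction, since there the cops can stay put.\<close>

definition cop_strategy :: "'a ugraph \<Rightarrow> nat \<Rightarrow> ('a list \<Rightarrow> 'a list) \<Rightarrow> bool" where
  "cop_strategy G m S \<longleftrightarrow>
     cop_placement G m (S []) \<and>
     (\<forall>h x. set h \<subseteq> verts G \<and> x \<in> verts G \<longrightarrow> cop_move G (S h) (S (h @ [x])))"

text \<open>\<open>r t\<close> is the vertex of the robber after \<open>t\<close> moves of the robber, and \<open>cops_at S r t\<close> is
  the configuration of the cops after \<open>t\<close> moves of the cops.\<close>

definition cops_at :: "('a list \<Rightarrow> 'a list) \<Rightarrow> (nat \<Rightarrow> 'a) \<Rightarrow> nat \<Rightarrow> 'a list" where
  "cops_at S r t = S (map r [0..<t])"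

definition robber_play :: "'a ugraph \<Rightarrow> ('a list \<Rightarrow> 'a list) \<Rightarrow> (nat \<Rightarrow> 'a) \<Rightarrow> bool" where
  "robber_play G S r \<longleftrightarrow>
     r 0 \<in> verts G \<and> r 0 \<notin> set (cops_at S r 0) \<and>
     (\<forall>t. (r (Suc t) = r t \<or> adj G (r t) (r (Suc t))) \<and>
          r (Suc t) \<notin> set (cops_at S r (Suc t)))"

text \<open>The robber may be surrounded directly after his own move (the first disjunct) or
  after a move of the cops (the second). It suffices to consider infinite plays: a robber without
  a legal move is surrounded (see \<open>no_robber_move_imp_surrounded\<close> below), so every play
  that cannot be continued has already been won by the cops.\<close>

definition winning_cop_strategy :: "'a ugraph \<Rightarrow> nat \<Rightarrow> ('a list \<Rightarrow> 'a list) \<Rightarrow> bool" where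
  "winning_cop_strategy G m S \<longleftrightarrow>
     cop_strategy G m S \<and>
     (\<forall>r. robber_play G S r \<longrightarrow>
        (\<exists>t. surrounded G (cops_at S r t) (r t) \<or>
             surrounded G (cops_at S r (Suc t)) (r t)))"

definition surrounding_cop_number :: "'a ugraph \<Rightarrow> nat" where
  "surrounding_cop_number G = (LEAST m. 1 \<le> m \<and> (\<exists>S. winning_cop_strategy G m S))"

lemma no_robber_move_imp_surrounded:
  assumes "\<forall>y. y = x \<or> adj G x y \<longrightarrow> y \<in> set c"
  shows "surrounded G c x"
  using assms by (simp add: surrounded_def)

text \<open>The minimum is attained on every nonempty finite graph: cops on all
  vertices leave the robber no starting vertex.\<close>

lemma ex_winning_cop_strategy:
  assumes "finite (verts G)" "verts G \<noteq> {}"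
  shows "\<exists>m\<ge>1. \<exists>S. winning_cop_strategy G m S"
proof -
  obtain vs where vs: "set vs = verts G"
    using assms(1) finite_list by blast
  have "1 \<le> length vs"
    using vs assms(2) by (cases vs) auto
  moreover have "winning_cop_strategy G (length vs) (\<lambda>_. vs)"
    using vs by (auto simp: winning_cop_strategy_def cop_strategy_def cop_placement_def
        cop_move_def robber_play_def cops_at_def list_all2_same)
  ultimately show ?thesis by blast
qed

datatype gp_vertex = Outer nat | Inner nat

definition GP :: "nat \<Rightarrow> nat \<Rightarrow> gp_vertex ugraph" where
  "GP n k =
     (Outer ` {..<n} \<union> Inner ` {..<n},
      \<Union>i<n. {{Outer i, Outer ((i + 1) mod n)},
              {Outer i, Inner i},
              {Inner i, Inner ((i + k) mod n)}})"

lemma add_mod_neq: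
  fixes i j n :: nat
  assumes "0 < j" "j < n" "i < n"
  shows "(i + j) mod n \<noteq> i"
  using assms by (cases "i + j < n") (auto simp: mod_if)

lemma finite_simple_graph_GP:
  assumes "1 \<le> k" "2 * k < n"
  shows "finite_simple_graph (GP n k)"
proof -
  have "(i + 1) mod n \<noteq> i" "(i + k) mod n \<noteq> i" if "i < n" for i
    using assms that add_mod_neq[of 1 n i] add_mod_neq[of k n i] by auto
  then have *: "i \<noteq> (i + 1) mod n" "i \<noteq> (i + k) mod n" if "i < n" for i
    using that by metis+
  show ?thesis
    unfolding finite_simple_graph_def GP_def
    using * assms by (fastforce simp: card_insert_if)
qed

end

theory Submission
  imports Defs
begin

text \<open>A cop in the robber's layer can copy every move of the robber and so keep her column
  difference to him. Two cops stay on the outer cycle and close in on the columns \<open>i \<plusminus> 1\<close>, where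
  \<open>i\<close> is the robber's column; the other two copy the robber at the columns \<open>i + k(1 + d)\<close> and
  \<open>i - k(1 + d')\<close>. Each inner move of the robber lets one of the latter gain by standing still, each
  outer move lets one of the former gain. Once the robber cannot leave his spoke, he is surrounded
  at the next use of it. To bring two cops into the right residue class modulo
  \<open>gcd(n,k)\<close> first, let them walk on the outer cycle in one direction: inner moves of the
  robber do not change his class, and a robber running away around the outer cycle is stopped by
  another cop.\<close>

section \<open>Winning positions\<close>

text \<open>Positions with the robber to move.\<close>

inductive cops_force :: "'a ugraph \<Rightarrow> 'a list \<Rightarrow> 'a \<Rightarrow> bool" for G where
  surround: "surrounded G c x \<Longrightarrow> cops_force G c x"
| reply: "(\<And>y. y = x \<or> adj G x y \<Longrightarrow> y \<notin> set c \<Longrightarrow> \<exists>c'. cop_move G c c' \<and> cops_force G c' y)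
    \<Longrightarrow> cops_force G c x"

fun cops_force_within :: "'a ugraph \<Rightarrow> nat \<Rightarrow> 'a list \<Rightarrow> 'a \<Rightarrow> bool" where
  "cops_force_within G 0 c x \<longleftrightarrow> surrounded G c x"
| "cops_force_within G (Suc m) c x \<longleftrightarrow> surrounded G c x \<or>
     (\<forall>y. (y = x \<or> adj G x y) \<and> y \<notin> set c \<longrightarrow>
        (\<exists>c'. cop_move G c c' \<and> cops_force_within G m c' y))"

lemma cops_force_within_Suc:
  "cops_force_within G m c x \<Longrightarrow> cops_force_within G (Suc m) c x"
proof (induction m arbitrary: c x)
  case (Suc m)
  then show ?case by (metis cops_force_within.simps(2))
qed simp

lemma cops_force_within_mono:
  "m \<le> m' \<Longrightarrow> cops_force_within G m c x \<Longrightarrow> cops_force_within G m' c x"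
  by (induction m' rule: dec_induct) (blast intro: cops_force_within_Suc)+

lemma adj_in_verts:
  assumes "finite_simple_graph G" "adj G x y"
  shows "x \<in> verts G" "y \<in> verts G"
  using assms by (auto simp: finite_simple_graph_def adj_def)

text \<open>The robber has finitely many answers, so the bounds for the replies have a maximum;
  infinite branching could call for an ordinal.\<close>

lemma cops_force_imp_within:
  assumes G: "finite_simple_graph G"
  shows "cops_force G c x \<Longrightarrow> \<exists>m. cops_force_within G m c x"
proof (induction rule: cops_force.induct)
  case (surround c x)
  then show ?case by (intro exI[of _ 0]) simp
next
  case (reply x c)
  then obtain f m where fm: "\<And>y. y = x \<or> adj G x y \<Longrightarrow> y \<notin> set c \<Longrightarrow>
      cop_move G c (f y) \<and> cops_force_within G (m y) (f y) y"
    by metis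
  define M where "M = Max (m ` insert x (verts G))"
  have "m y \<le> M" if "y = x \<or> adj G x y" for y
    using that G adj_in_verts[OF G] unfolding M_def
    by (intro Max_ge) (auto simp: finite_simple_graph_def)
  then have "cops_force_within G (Suc M) c x"
    using fm cops_force_within_mono by (metis cops_force_within.simps(2))
  then show ?case ..
qed

text \<open>The choice of a reply must decrease the number of remaining moves: a reply that merely leads
  to another winning position could be repeated forever.\<close>

lemma winning_strategy_if_cops_force:
  assumes G: "finite_simple_graph G" and c0: "cop_placement G m c0"
    and force: "\<And>x. x \<in> verts G \<Longrightarrow> x \<notin> set c0 \<Longrightarrow> \<exists>c. cop_move G c0 c \<and> cops_force G c x"
  shows "\<exists>S. winning_cop_strategy G m S"
proof -
  define ahead where "ahead j c x c' \<longleftrightarrow> cop_move G c c' \<and> cops_force_within G j c' x" for j c x c'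
  \<comment> \<open>Taking the least bound first makes it drop in every round; staying put elsewhere
    keeps the strategy legal on all histories.\<close>
  define step where "step c x = (if \<exists>j c'. ahead j c x c'
      then SOME c'. ahead (LEAST j. \<exists>c'. ahead j c x c') c x c' else c)" for c x
  have step: "ahead (LEAST j. \<exists>c'. ahead j c x c') c x (step c x)" if "ahead j c x c'" for j c x c'
  proof -
    have "\<exists>c'. ahead (LEAST j. \<exists>c'. ahead j c x c') c x c'"
      using that by (intro LeastI[of "\<lambda>j. \<exists>c'. ahead j c x c'" j]) blast
    moreover have "\<exists>j c'. ahead j c x c'" using that by blast
    ultimately show ?thesis
      by (simp add: step_def someI_ex)
  qed
  have step_within: "cops_force_within G j (step c x) x" if "ahead j c x c'" for j c x c'
  proof -
    have "(LEAST j. \<exists>c'. ahead j c x c') \<le> j"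
      using that by (intro Least_le) blast
    moreover have "cops_force_within G (LEAST j. \<exists>c'. ahead j c x c') (step c x) x"
      using step[OF that] by (simp only: ahead_def)
    ultimately show ?thesis by (rule cops_force_within_mono)
  qed
  have step_move: "cop_move G c (step c x)" for c x
  proof (cases "\<exists>j c'. ahead j c x c'")
    case True
    then obtain j c' where "ahead j c x c'" by blast
    from step[OF this] show ?thesis by (simp only: ahead_def)
  next
    case False
    then show ?thesis by (simp add: step_def cop_move_def list_all2_same)
  qed
  define S where "S h = foldl step c0 h" for h
  have S: "cop_strategy G m S"
    using c0 step_move by (simp add: cop_strategy_def S_def)
  have "\<exists>t. surrounded G (cops_at S r (Suc t)) (r t)" if r: "robber_play G S r" for r
  proof (rule ccontr)
    assume neg: "\<nexists>t. surrounded G (cops_at S r (Suc t)) (r t)"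
    have at_Suc: "cops_at S r (Suc t) = step (cops_at S r t) (r t)" for t
      by (simp add: cops_at_def S_def)
    have "r 0 \<in> verts G" "r 0 \<notin> set c0"
      using r by (auto simp: robber_play_def cops_at_def S_def)
    from force[OF this] cops_force_imp_within[OF G] obtain j c where "ahead j c0 (r 0) c"
      unfolding ahead_def by blast
    then have init: "cops_force_within G j (cops_at S r (Suc 0)) (r 0)"
      using step_within by (simp add: cops_at_def S_def)
    have "cops_force_within G (j - t) (cops_at S r (Suc t)) (r t)" for t
    proof (induction t)
      case 0
      then show ?case using init by simp
    next
      case (Suc t)
      then obtain l where l: "j - t = Suc l"
        using neg by (cases "j - t") auto
      have "(r (Suc t) = r t \<or> adj G (r t) (r (Suc t))) \<and> r (Suc t) \<notin> set (cops_at S r (Suc t))"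
        using r by (simp add: robber_play_def)
      then obtain c' where "ahead l (cops_at S r (Suc t)) (r (Suc t)) c'"
        using Suc l neg unfolding ahead_def by auto
      moreover have "j - Suc t = l" using l by simp
      ultimately show ?case
        using step_within at_Suc by metis
    qed
    from this[of j] neg show False by simp
  qed
  with S show ?thesis
    unfolding winning_cop_strategy_def by blast
qed

section \<open>Generalised Petersen graphs with integer subscripts\<close>

locale generalised_petersen =
  fixes n k :: nat
  assumes n_pos: "0 < n"
begin

abbreviation G :: "gp_vertex ugraph" where "G \<equiv> GP n k"

text \<open>Integer subscripts reduced modulo \<open>n\<close> let \<open>i - 1\<close> and
  \<open>i - int k\<close> wrap around without truncated subtraction.\<close>

definition a :: "int \<Rightarrow> gp_vertex" where "a i = Outer (nat (i mod int n))"

definition b :: "int \<Rightarrow> gp_vertex" where "b i = Inner (nat (i mod int n))"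

lemma nat_mod_eq_iff: "nat (i mod int n) = nat (j mod int n) \<longleftrightarrow> i mod int n = j mod int n"
  using n_pos by (metis nat_eq_iff2 of_nat_0_less_iff pos_mod_sign)

lemma a_eq_iff: "a i = a j \<longleftrightarrow> i mod int n = j mod int n"
  by (simp add: a_def nat_mod_eq_iff)

lemma b_eq_iff: "b i = b j \<longleftrightarrow> i mod int n = j mod int n"
  by (simp add: b_def nat_mod_eq_iff)

lemma Outer_mod: "Outer (j mod n) = a (int j)"
  by (simp add: a_def nat_mod_as_int)

lemma Inner_mod: "Inner (j mod n) = b (int j)"
  by (simp add: b_def nat_mod_as_int)

lemma verts_cases:
  assumes "x \<in> verts G"
  obtains i where "x = a i" | i where "x = b i"
  using assms by (auto simp: GP_def a_def b_def) (metis mod_less nat_int of_nat_mod)+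

lemma a_in_verts: "a i \<in> verts G"
  using n_pos by (simp add: GP_def a_def nat_less_iff)

lemma edges_eq: "edges G = (\<Union>i. {{a i, a (i + 1)}, {a i, b i}, {b i, b (i + int k)}})"
proof -
  have col: "Outer j = a (int j)" "Inner j = b (int j)" if "j < n" for j
    using that by (simp_all add: a_def b_def)
  have "edges G = (\<Union>j<n. {{a (int j), a (int j + 1)}, {a (int j), b (int j)},
      {b (int j), b (int j + int k)}})"
    unfolding GP_def by (simp add: Outer_mod Inner_mod col add.commute)
  also have "\<dots> = (\<Union>i. {{a i, a (i + 1)}, {a i, b i}, {b i, b (i + int k)}})" (is "?L = ?R")
  proof
    show "?R \<subseteq> ?L"
    proof
      fix e assume "e \<in> ?R"
      then obtain i where i: "e \<in> {{a i, a (i + 1)}, {a i, b i}, {b i, b (i + int k)}}" by blast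
      define j where "j = nat (i mod int n)"
      have j: "int j = i mod int n" "j < n"
        using n_pos by (auto simp: j_def nat_less_iff)
      have "a i = a (int j)" "a (i + 1) = a (int j + 1)" "b i = b (int j)"
        "b (i + int k) = b (int j + int k)"
        by (simp_all add: j a_eq_iff b_eq_iff mod_add_left_eq)
      with i have "e \<in> {{a (int j), a (int j + 1)}, {a (int j), b (int j)},
          {b (int j), b (int j + int k)}}" by (simp only:)
      then show "e \<in> ?L" using j(2) by blast
    qed
  qed auto
  finally show ?thesis .
qed

lemma adj_a: "adj G (a i) y \<longleftrightarrow> y = a (i + 1) \<or> y = a (i - 1) \<or> y = b i"
proof
  assume "adj G (a i) y"
  then obtain j where "{a i, y} = {a j, a (j + 1)} \<or> {a i, y} = {a j, b j}"
    unfolding adj_def edges_eq by (auto simp: a_def b_def doubleton_eq_iff)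
  then have "(a i = a j \<and> y = a (j + 1)) \<or> (a i = a (j + 1) \<and> y = a j) \<or> (a i = a j \<and> y = b j)"
    by (auto simp: doubleton_eq_iff a_def b_def)
  moreover have "a (j + 1) = a (i + 1)" "b j = b i" if "a i = a j"
    using that by (auto simp: a_eq_iff b_eq_iff intro: mod_add_cong)
  moreover have "a j = a (i - 1)" if "a i = a (j + 1)"
    using that mod_diff_cong[of i "int n" "j + 1" 1 1] by (simp add: a_eq_iff)
  ultimately show "y = a (i + 1) \<or> y = a (i - 1) \<or> y = b i" by metis
next
  have "{a i, a (i - 1)} = {a (i - 1), a (i - 1 + 1)}" by auto
  moreover assume "y = a (i + 1) \<or> y = a (i - 1) \<or> y = b i"
  ultimately show "adj G (a i) y" unfolding adj_def edges_eq by blast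
qed

lemma adj_b: "adj G (b i) y \<longleftrightarrow> y = b (i + int k) \<or> y = b (i - int k) \<or> y = a i"
proof
  assume "adj G (b i) y"
  then obtain j where "{b i, y} = {b j, b (j + int k)} \<or> {b i, y} = {a j, b j}"
    unfolding adj_def edges_eq by (auto simp: a_def b_def doubleton_eq_iff)
  then have "(b i = b j \<and> y = b (j + int k)) \<or> (b i = b (j + int k) \<and> y = b j)
      \<or> (b i = b j \<and> y = a j)"
    by (auto simp: doubleton_eq_iff a_def b_def)
  moreover have "b (j + int k) = b (i + int k)" "a j = a i" if "b i = b j"
    using that by (auto simp: a_eq_iff b_eq_iff intro: mod_add_cong)
  moreover have "b j = b (i - int k)" if "b i = b (j + int k)"
    using that mod_diff_cong[of i "int n" "j + int k" "int k" "int k"] by (simp add: b_eq_iff)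
  ultimately show "y = b (i + int k) \<or> y = b (i - int k) \<or> y = a i" by metis
next
  have "{b i, b (i - int k)} = {b (i - int k), b (i - int k + int k)}" "{b i, a i} = {a i, b i}"
    by auto
  moreover assume "y = b (i + int k) \<or> y = b (i - int k) \<or> y = a i"
  ultimately show "adj G (b i) y" unfolding adj_def edges_eq by blast
qed

definition reach :: "gp_vertex \<Rightarrow> gp_vertex \<Rightarrow> bool" where
  "reach u v \<longleftrightarrow> v = u \<or> adj G u v"

lemma reach_refl: "reach u u"
  by (simp add: reach_def)

lemma reach_aa: "y = x \<or> y = x + 1 \<or> y = x - 1 \<Longrightarrow> reach (a x) (a y)"
  by (auto simp: reach_def adj_a)

lemma reach_bb: "y = x \<or> y = x + int k \<or> y = x - int k \<Longrightarrow> reach (b x) (b y)"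
  by (auto simp: reach_def adj_b)

lemma reach_ab: "reach (a x) (b x)" and reach_ba: "reach (b x) (a x)"
  by (auto simp: reach_def adj_a adj_b)

text \<open>The counterpart of \<open>cops_force\<close> with the cops to move.\<close>

definition force_after :: "gp_vertex list \<Rightarrow> gp_vertex \<Rightarrow> bool" where
  "force_after c x \<longleftrightarrow> (\<exists>c'. cop_move G c c' \<and> cops_force G c' x)"

lemma force_afterI:
  assumes "cops_force G [q1, q2, q3, q4] x"
    and "reach p1 q1" "reach p2 q2" "reach p3 q3" "reach p4 q4"
  shows "force_after [p1, p2, p3, p4] x"
  using assms unfolding force_after_def cop_move_def reach_def
  by (intro exI[of _ "[q1, q2, q3, q4]"]) auto

lemma cops_force_aI:
  assumes "force_after c (a i)" "a (i + 1) \<notin> set c \<Longrightarrow> force_after c (a (i + 1))"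
    "a (i - 1) \<notin> set c \<Longrightarrow> force_after c (a (i - 1))" "force_after c (b i)"
  shows "cops_force G c (a i)"
  using assms unfolding force_after_def by (intro cops_force.reply) (auto simp: adj_a)

lemma cops_force_bI:
  assumes "force_after c (b i)" "b (i + int k) \<notin> set c \<Longrightarrow> force_after c (b (i + int k))"
    "b (i - int k) \<notin> set c \<Longrightarrow> force_after c (b (i - int k))" "force_after c (a i)"
  shows "cops_force G c (b i)"
  using assms unfolding force_after_def by (intro cops_force.reply) (auto simp: adj_b)

lemma cops_force_surround_a:
  "{a (i + 1), a (i - 1), b i} \<subseteq> set c \<Longrightarrow> cops_force G c (a i)"
  by (intro cops_force.surround) (auto simp: surrounded_def adj_a)

lemma cops_force_surround_b:
  "{b (i + int k), b (i - int k), a i} \<subseteq> set c \<Longrightarrow> cops_force G c (b i)"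
  by (intro cops_force.surround) (auto simp: surrounded_def adj_b)

section \<open>The pursuit\<close>

text \<open>Columns relative to the robber in column \<open>i\<close>: the two outer cops aim at distance \<open>0\<close>, that
  is, at the columns \<open>i \<plusminus> 1\<close>, and the two inner cops at the columns \<open>i \<plusminus> k\<close>.\<close>

definition rt :: "int \<Rightarrow> nat \<Rightarrow> int" where "rt i d = i + 1 + int d"
definition lt :: "int \<Rightarrow> nat \<Rightarrow> int" where "lt i d = i - 1 - int d"
definition up :: "int \<Rightarrow> nat \<Rightarrow> int" where "up i d = i + int k * (1 + int d)"
definition dn :: "int \<Rightarrow> nat \<Rightarrow> int" where "dn i d = i - int k * (1 + int d)"

text \<open>Since \<open>0 - 1 = 0\<close> on naturals, a cop that has arrived simply stays.\<close>

lemma reach_rt: "reach (a (rt i d)) (a (rt i (d - 1)))"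
  and reach_lt: "reach (a (lt i d)) (a (lt i (d - 1)))"
  and reach_up: "reach (b (up i d)) (b (up i (d - 1)))"
  and reach_dn: "reach (b (dn i d)) (b (dn i (d - 1)))"
  by (cases d; auto intro!: reach_aa reach_bb simp: rt_def lt_def up_def dn_def algebra_simps)+

lemma reach_mirror_a:
  "reach (a (rt i d)) (a (rt (i - 1) d))" "reach (a (rt i d)) (a (rt (i + 1) d))"
  "reach (a (lt i d)) (a (lt (i - 1) d))" "reach (a (lt i d)) (a (lt (i + 1) d))"
  "reach (a (up i d)) (a (up (i - 1) d))" "reach (a (up i d)) (a (up (i + 1) d))"
  "reach (a (dn i d)) (a (dn (i - 1) d))" "reach (a (dn i d)) (a (dn (i + 1) d))"
  by (auto intro!: reach_aa simp: rt_def lt_def up_def dn_def algebra_simps)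

lemma reach_mirror_b:
  "reach (b (up i d)) (b (up (i - int k) d))" "reach (b (up i d)) (b (up (i + int k) d))"
  "reach (b (dn i d)) (b (dn (i - int k) d))" "reach (b (dn i d)) (b (dn (i + int k) d))"
  by (auto intro!: reach_bb simp: up_def dn_def algebra_simps)

text \<open>The robber moves towards the cop, so she gains by standing still: for positive
  \<open>d\<close> both columns coincide.\<close>

lemma reach_approach:
  "d \<noteq> 0 \<Longrightarrow> reach (a (rt i d)) (a (rt (i + 1) (d - 1)))"
  "d \<noteq> 0 \<Longrightarrow> reach (a (lt i d)) (a (lt (i - 1) (d - 1)))"
  "d \<noteq> 0 \<Longrightarrow> reach (b (up i d)) (b (up (i + int k) (d - 1)))"
  "d \<noteq> 0 \<Longrightarrow> reach (b (dn i d)) (b (dn (i - int k) (d - 1)))"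
  by (cases d; auto intro!: reach_aa reach_bb simp: rt_def lt_def up_def dn_def algebra_simps)+

lemma at_zero: "rt i 0 = i + 1" "lt i 0 = i - 1" "up i 0 = i + int k" "dn i 0 = i - int k"
  by (simp_all add: rt_def lt_def up_def dn_def)

text \<open>On a cycle every column lies on either side of the robber at some distance, so an outer
  cop can take either role.\<close>

lemma ex_rt: "\<exists>d. a x = a (rt i d)"
  using n_pos by (intro exI[of _ "nat ((x - i - 1) mod int n)"])
    (simp add: a_eq_iff rt_def mod_add_right_eq)

lemma ex_lt: "\<exists>d. a x = a (lt i d)"
  using n_pos by (intro exI[of _ "nat ((i - 1 - x) mod int n)"])
    (simp add: a_eq_iff lt_def mod_diff_right_eq)

text \<open>Changing \<open>q\<close> by a multiple of \<open>n\<close> makes the multiplier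
  positive, as \<open>up\<close> and \<open>dn\<close> require.\<close>

lemma ex_nat_mod: "\<exists>d. (int k * q) mod int n = (int k * (1 + int d)) mod int n"
proof -
  have "int k * (1 + (q - 1) mod int n) mod int n = int k * (1 + (q - 1)) mod int n"
    by (metis mod_add_right_eq mod_mult_right_eq)
  then show ?thesis
    using n_pos by (intro exI[of _ "nat ((q - 1) mod int n)"]) simp
qed

lemma ex_up: "\<exists>d. (i + int k * q) mod int n = up i d mod int n"
  using ex_nat_mod[of q] unfolding up_def by (metis mod_add_right_eq)

lemma ex_dn: "\<exists>d. (i + int k * q) mod int n = dn i d mod int n"
proof -
  obtain d where "(int k * (- q)) mod int n = (int k * (1 + int d)) mod int n"
    using ex_nat_mod by blast
  then have "(i - int k * (- q)) mod int n = (i - int k * (1 + int d)) mod int n"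
    by (metis mod_diff_right_eq)
  then show ?thesis by (auto simp: dn_def)
qed

definition "forced_a i d1 d2 d3 d4 \<longleftrightarrow>
  cops_force G [a (rt i d1), a (lt i d2), a (up i d3), a (dn i d4)] (a i)"

definition "forced_b i d1 d2 d3 d4 \<longleftrightarrow>
  cops_force G [a (rt i d1), a (lt i d2), b (up i d3), b (dn i d4)] (b i)"

text \<open>The last two cops stay in the inner layer while the robber is at the outer end of his
  spoke, with both outer neighbours occupied.\<close>

definition "trapped i d3 d4 \<longleftrightarrow>
  cops_force G [a (rt i 0), a (lt i 0), b (up i d3), b (dn i d4)] (a i)"

lemmas reach_rules = reach_refl reach_ab reach_ba reach_rt reach_lt reach_up reach_dn
  reach_mirror_a reach_mirror_b reach_approach

text \<open>An inner move of the robber may throw the outer cops off arbitrarily, but each such move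
  brings an inner cop closer. So the pair (inner distances, outer distances) decreases
  lexicographically until the robber is confined to a single spoke, where the positions
  decrease in the order \<open>forced_a\<close>, \<open>trapped\<close>, \<open>forced_b\<close>.\<close>

lemma forced:
  "(\<forall>i d1 d2. forced_a i d1 d2 d3 d4 \<and> forced_b i d1 d2 d3 d4) \<and> (\<forall>i. trapped i d3 d4)"
proof (induction "d3 + d4" arbitrary: d3 d4 rule: less_induct)
  case less
  have IHa: "forced_a i d1 d2 e3 e4" and IHb: "forced_b i d1 d2 e3 e4" and IHt: "trapped i e3 e4"
    if "e3 + e4 < d3 + d4" for i d1 d2 e3 e4
    using less[OF that] by blast+
  \<comment> \<open>If \<open>b (i + int k)\<close> is free then \<open>d3\<close> is positive, so
    the third cop gains by waiting. The outer distances are read afresh, as the induction on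
    \<open>d3 + d4\<close> allows any values.\<close>
  have plus: "force_after [a x, a y, b (up i d3), b (dn i d4)] (b (i + int k))"
    if "b (i + int k) \<notin> {b (up i d3), b (dn i d4)}" for i x y
  proof -
    have "d3 \<noteq> 0" using that by (cases d3) (auto simp: at_zero)
    obtain d1 d2 where d: "a x = a (rt (i + int k) d1)" "a y = a (lt (i + int k) d2)"
      using ex_rt ex_lt by blast
    have "forced_b (i + int k) d1 d2 (d3 - 1) d4"
      using \<open>d3 \<noteq> 0\<close> by (intro IHb) simp
    then show ?thesis
      unfolding d forced_b_def by (rule force_afterI) (rule reach_rules \<open>d3 \<noteq> 0\<close>)+
  qed
  have minus: "force_after [a x, a y, b (up i d3), b (dn i d4)] (b (i - int k))"
    if "b (i - int k) \<notin> {b (up i d3), b (dn i d4)}" for i x y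
  proof -
    have "d4 \<noteq> 0" using that by (cases d4) (auto simp: at_zero)
    obtain d1 d2 where d: "a x = a (rt (i - int k) d1)" "a y = a (lt (i - int k) d2)"
      using ex_rt ex_lt by blast
    have "forced_b (i - int k) d1 d2 d3 (d4 - 1)"
      using \<open>d4 \<noteq> 0\<close> by (intro IHb) simp
    then show ?thesis
      unfolding d forced_b_def by (rule force_afterI) (rule reach_rules \<open>d4 \<noteq> 0\<close>)+
  qed
  have dec: "d3 - 1 + (d4 - 1) < d3 + d4" if "d3 + d4 \<noteq> 0"
    using that by auto
  \<comment> \<open>The first cop steps onto \<open>a i\<close>; the inner cops already hold the
    other two neighbours. In \<open>close_a\<close> the third cop steps onto \<open>b i\<close>
    instead.\<close>
  have close_b: "force_after [a (rt i 0), a (lt i 0), b (up i d3), b (dn i d4)] (b i)"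
    if "d3 + d4 = 0" for i
    using that by (intro force_afterI[OF cops_force_surround_b, of i "a i" "a (lt i 0)"
        "b (up i d3)" "b (dn i d4)"]) (auto simp: at_zero intro!: reach_aa reach_refl)
  have close_a: "force_after [a (rt i 0), a (lt i 0), b (up i d3), b (dn i d4)] (a i)"
    if "d3 + d4 = 0" for i
    using that by (intro force_afterI[OF cops_force_surround_a, of i "a (rt i 0)" "a (lt i 0)"
        "b i" "b (dn i d4)"]) (auto simp: at_zero intro!: reach_bb reach_refl)
  \<comment> \<open>The inner cops do not follow the robber to \<open>a i\<close> but use the round
    to come closer.\<close>
  have squeeze: "force_after [a (rt i 0), a (lt i 0), b (up i d3), b (dn i d4)] (a i)" for i
  proof (cases "d3 + d4 = 0")
    case False
    show ?thesis
      using IHt[OF dec[OF False], of i] unfolding trapped_def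
      by (rule force_afterI) (rule reach_rules)+
  qed (rule close_a)
  have b0: "forced_b i 0 0 d3 d4" for i
    unfolding forced_b_def
  proof (rule cops_force_bI)
    show "force_after [a (rt i 0), a (lt i 0), b (up i d3), b (dn i d4)] (b i)"
    proof (cases "d3 + d4 = 0")
      case False
      show ?thesis
        using IHb[OF dec[OF False], of i 0 0] unfolding forced_b_def
        by (rule force_afterI) (rule reach_rules)+
    qed (rule close_b)
  qed (auto intro: plus minus squeeze)
  have t: "trapped i d3 d4" for i
    unfolding trapped_def
  proof (rule cops_force_aI)
    show "force_after [a (rt i 0), a (lt i 0), b (up i d3), b (dn i d4)] (b i)"
      using b0[of i] unfolding forced_b_def by (rule force_afterI) (rule reach_rules)+
  qed (rule squeeze, auto simp: at_zero)
  have a0: "forced_a i 0 0 d3 d4" for i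
    unfolding forced_a_def
  proof (rule cops_force_aI)
    \<comment> \<open>While the robber waits, the last two cops descend their spokes.\<close>
    show "force_after [a (rt i 0), a (lt i 0), a (up i d3), a (dn i d4)] (a i)"
      using t[of i] unfolding trapped_def by (rule force_afterI) (rule reach_rules)+
    show "force_after [a (rt i 0), a (lt i 0), a (up i d3), a (dn i d4)] (b i)"
      using b0[of i] unfolding forced_b_def by (rule force_afterI) (rule reach_rules)+
  qed (auto simp: at_zero)
  \<comment> \<open>Waiting and spoke moves lower every positive outer distance; a step along the
    outer cycle lowers the one ahead.\<close>
  have "forced_a i d1 d2 d3 d4 \<and> forced_b i d1 d2 d3 d4" for i d1 d2
  proof (induction "d1 + d2" arbitrary: i d1 d2 rule: less_induct)
    case less
    show ?case
    proof (cases "d1 + d2 = 0")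
      case True
      then show ?thesis using a0 b0 by simp
    next
      case False
      then have "d1 - 1 + (d2 - 1) < d1 + d2" by auto
      then have both: "forced_a i (d1 - 1) (d2 - 1) d3 d4" "forced_b i (d1 - 1) (d2 - 1) d3 d4"
        using less by blast+
      have right: "forced_a (i + 1) (d1 - 1) d2 d3 d4" if "d1 \<noteq> 0"
        using less[of "d1 - 1" d2] that by simp
      have left: "forced_a (i - 1) d1 (d2 - 1) d3 d4" if "d2 \<noteq> 0"
        using less[of d1 "d2 - 1"] that by simp
      have "forced_a i d1 d2 d3 d4"
        unfolding forced_a_def
      proof (rule cops_force_aI)
        let ?c = "[a (rt i d1), a (lt i d2), a (up i d3), a (dn i d4)]"
        show "force_after ?c (a i)"
          using both(1) unfolding forced_a_def by (rule force_afterI) (rule reach_rules)+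
        show "force_after ?c (b i)"
          using both(2) unfolding forced_b_def by (rule force_afterI) (rule reach_rules)+
        show "force_after ?c (a (i + 1))" if "a (i + 1) \<notin> set ?c"
        proof -
          have "d1 \<noteq> 0" using that by (cases d1) (auto simp: at_zero)
          from right[OF this] show ?thesis
            unfolding forced_a_def by (rule force_afterI) (rule reach_rules \<open>d1 \<noteq> 0\<close>)+
        qed
        show "force_after ?c (a (i - 1))" if "a (i - 1) \<notin> set ?c"
        proof -
          have "d2 \<noteq> 0" using that by (cases d2) (auto simp: at_zero)
          from left[OF this] show ?thesis
            unfolding forced_a_def by (rule force_afterI) (rule reach_rules \<open>d2 \<noteq> 0\<close>)+
        qed
      qed
      moreover have "forced_b i d1 d2 d3 d4"
        unfolding forced_b_def
      proof (rule cops_force_bI)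
        let ?c = "[a (rt i d1), a (lt i d2), b (up i d3), b (dn i d4)]"
        show "force_after ?c (b i)"
          using both(2) unfolding forced_b_def by (rule force_afterI) (rule reach_rules)+
        show "force_after ?c (a i)"
          using both(1) unfolding forced_a_def by (rule force_afterI) (rule reach_rules)+
      qed (auto intro: plus minus)
      ultimately show ?thesis ..
    qed
  qed
  with t show ?case by blast
qed

section \<open>Reaching the right residue class\<close>

text \<open>Modulo \<open>n\<close>, a column of the robber's class lies ahead of him in both
  directions, so two cops standing there can split into the roles \<open>up\<close> and
  \<open>dn\<close>.\<close>

lemma aligned_a: "cops_force G [a x, a y, a (i + int k * q), a (i + int k * q)] (a i)"
proof -
  obtain d1 d2 d3 d4 where "a x = a (rt i d1)" "a y = a (lt i d2)"
    "(i + int k * q) mod int n = up i d3 mod int n" "(i + int k * q) mod int n = dn i d4 mod int n"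
    using ex_rt ex_lt ex_up ex_dn by metis
  then show ?thesis
    using forced[of d3 d4] unfolding forced_a_def a_eq_iff[symmetric] by metis
qed

lemma aligned_b: "cops_force G [a x, a y, b (i + int k * q), b (i + int k * q)] (b i)"
proof -
  obtain d1 d2 d3 d4 where "a x = a (rt i d1)" "a y = a (lt i d2)"
    "(i + int k * q) mod int n = up i d3 mod int n" "(i + int k * q) mod int n = dn i d4 mod int n"
    using ex_rt ex_lt ex_up ex_dn by metis
  then show ?thesis
    using forced[of d3 d4] unfolding forced_b_def b_eq_iff[symmetric] by metis
qed

text \<open>One round removes the difference in layers: the pair descends, and an inner step of the
  robber only changes \<open>q\<close>.\<close>

lemma aligned_ab: "cops_force G [a x, a y, a (i + int k * q), a (i + int k * q)] (b i)"
proof (rule cops_force_bI)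
  let ?c = "[a x, a y, a (i + int k * q), a (i + int k * q)]"
  have shift: "i + int k + int k * (q - 1) = i + int k * q" "i - int k + int k * (q + 1) = i + int k * q"
    by (simp_all add: algebra_simps)
  show "force_after ?c (b i)"
    using aligned_b by (rule force_afterI) (rule reach_rules)+
  show "force_after ?c (b (i + int k))"
    using aligned_b[of x y "i + int k" "q - 1"] unfolding shift
    by (rule force_afterI) (rule reach_rules)+
  show "force_after ?c (b (i - int k))"
    using aligned_b[of x y "i - int k" "q + 1"] unfolding shift
    by (rule force_afterI) (rule reach_rules)+
  show "force_after ?c (a i)"
    using aligned_a by (rule force_afterI) (rule reach_rules)+
qed

text \<open>With all cops on the outer cycle, every move of the robber other than one to \<open>a (i - 1)\<close> lets
  the last two cops decrease \<open>e\<close>; consecutive moves of that kind are limited by the second cop.\<close>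

lemma cops_force_outer:
  "cops_force G [a x, a y, a (i + int e + int k * q), a (i + int e + int k * q)] (a i) \<and>
   cops_force G [a x, a y, a (i + int e + int k * q), a (i + int e + int k * q)] (b i)"
proof (induction e arbitrary: x y i q)
  case 0
  then show ?case using aligned_a aligned_ab by simp
next
  case (Suc e)
  note IH = Suc
  let ?c = "\<lambda>y i q. [a x, a y, a (i + int (Suc e) + int k * q), a (i + int (Suc e) + int k * q)]"
  \<comment> \<open>The pair steps left by one column or waits; for suitable \<open>j\<close> and
    \<open>q'\<close> either lowers \<open>e\<close>.\<close>
  have near: "force_after (?c y i q) z"
    if "cops_force G [a x, a y, a (j + int e + int k * q'), a (j + int e + int k * q')] z"
      "i + int e + int k * q = j + int e + int k * q' \<or>
       i + int (Suc e) + int k * q = j + int e + int k * q'" for y i q j q' z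
    using that(1) by (rule force_afterI) (use that(2) in \<open>auto intro!: reach_aa reach_refl\<close>)
  have inner: "cops_force G (?c y i q) (b i)"
  proof (rule cops_force_bI)
    show "force_after (?c y i q) (b i)" "force_after (?c y i q) (a i)"
      using near IH by blast+
    show "force_after (?c y i q) (b (i + int k))"
      by (rule near[OF conjunct2[OF IH[of x y "i + int k" "q - 1"]]]) (simp add: algebra_simps)
    show "force_after (?c y i q) (b (i - int k))"
      by (rule near[OF conjunct2[OF IH[of x y "i - int k" "q + 1"]]]) (simp add: algebra_simps)
  qed
  have outer: "cops_force G (?c (lt i d) i q) (a i)" for i d
  proof (induction d arbitrary: i)
    case 0
    show ?case
    proof (rule cops_force_aI)
      show "force_after (?c (lt i 0) i q) (a (i + 1))"
        by (rule near[OF conjunct1[OF IH[of x "lt i 0" "i + 1" q]]]) (simp add: algebra_simps)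
      show "force_after (?c (lt i 0) i q) (a i)" "force_after (?c (lt i 0) i q) (b i)"
        using near IH by blast+
    qed (simp add: at_zero)
  next
    case (Suc d)
    show ?case
    proof (rule cops_force_aI)
      show "force_after (?c (lt i (Suc d)) i q) (a (i + 1))"
        by (rule near[OF conjunct1[OF IH[of x "lt i (Suc d)" "i + 1" q]]]) (simp add: algebra_simps)
      show "force_after (?c (lt i (Suc d)) i q) (a i)" "force_after (?c (lt i (Suc d)) i q) (b i)"
        using near IH by blast+
      have "lt (i - 1) d = lt i (Suc d)" by (simp add: lt_def)
      then show "force_after (?c (lt i (Suc d)) i q) (a (i - 1))"
        using Suc[of "i - 1"] by (intro force_afterI) (auto intro!: reach_aa reach_refl)
    qed
  qed
  obtain d where "a y = a (lt i d)" using ex_lt by blast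
  then show ?case using inner outer[of i d] by simp
qed

lemma cops_force_outer_start:
  assumes "x \<in> verts G"
  shows "cops_force G [a 0, a 0, a 0, a 0] x"
proof -
  \<comment> \<open>Column \<open>0\<close> is \<open>(- i) mod n\<close> steps to the right of
    column \<open>i\<close>, so the common start has the required form with
    \<open>q = 0\<close>.\<close>
  have "a 0 = a (i + int (nat ((- i) mod int n)) + int k * 0)" for i
    using n_pos by (simp add: a_eq_iff mod_add_right_eq)
  then show ?thesis
    using assms cops_force_outer by (metis verts_cases)
qed

end

theorem theorem27:
  fixes n k :: nat
  assumes "n \<ge> 5" and "k \<ge> 2" and "n > 2 * k"
  shows "surrounding_cop_number (GP n k) \<le> 4"
proof -
  interpret generalised_petersen n k
    using assms by unfold_locales auto
  have "cop_placement G 4 [a 0, a 0, a 0, a 0]"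
    by (simp add: cop_placement_def a_in_verts)
  \<comment> \<open>The cops pass in their first move, as their placement already wins against every
    robber vertex.\<close>
  moreover have "cop_move G c c" for c
    by (simp add: cop_move_def list_all2_same)
  ultimately have "\<exists>S. winning_cop_strategy G 4 S"
    using assms cops_force_outer_start
    by (intro winning_strategy_if_cops_force finite_simple_graph_GP) auto
  then show ?thesis
    unfolding surrounding_cop_number_def by (intro Least_le) simp
qed

end
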